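(* Let $f:\mathbb{CP}^2\to\mathbb{CP}^2$ be the deltoid map $f([x:y:z])=[y^2-2xz:x^2-2yz:z^2]$, and let $J$ be its Julia set. Then in $\mathbb{C}^2$ the Julia set is the real hypersurface having the equation $$2\operatorname{Re}\left[(x-\bar y)^3\right]+\operatorname{Re}\left[(x-\bar y)^2(\bar x^2-y^2)\right]=0;$$ that is, $J\cap\mathbb{C}^2$ is exactly the set of $(x,y)\in\mathbb{C}^2$ satisfying this equation.
   Context: $\mathbb{C}^2$ is embedded in $\mathbb{CP}^2$ by $(x,y)\mapsto[x:y:1]$; on $\mathbb{C}^2$, $f(x,y)=(y^2-2x,x^2-2y)$. The Fatou set $\Omega$ of $f$ is the largest open subset of $\mathbb{CP}^2$ on which the iterates $\{f^n\}_{n\ge0}$ locally form an equicontinuous family (for a metric inducing the topology of $\mathbb{CP}^2$), and the Julia set is $J=\mathbb{CP}^2\setminus\Omega$. *)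

theory Defs
  imports "HOL-Analysis.Analysis"
begin

text \<open>The complex projective plane: nonzero vectors of $\mathbb{C}^3$ up to a scalar factor.\<close>

definition proportional :: "complex ^ 3 \<Rightarrow> complex ^ 3 \<Rightarrow> bool" where
  "proportional u v \<longleftrightarrow> u \<noteq> 0 \<and> v \<noteq> 0 \<and> (\<exists>c. v = c *s u)"

lemma part_equivp_proportional: "part_equivp proportional"
proof (rule part_equivpI)
  have "proportional 1 1"
    unfolding proportional_def by (auto intro!: exI[of _ 1])
  then show "\<exists>u. proportional u u" by blast
  show "symp proportional"
  proof (rule sympI)
    fix u v assume "proportional u v"
    then obtain c where uv: "u \<noteq> 0" "v \<noteq> 0" "v = c *s u"
      unfolding proportional_def by blast
    then have "c \<noteq> 0" by auto
    then have "u = inverse c *s v" using uv(3) by (simp add: vector_smult_assoc)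
    then show "proportional v u" using uv unfolding proportional_def by blast
  qed
  show "transp proportional"
    by (rule transpI) (auto simp: proportional_def vector_smult_assoc)
qed

quotient_type cp2 = "complex ^ 3" / partial: proportional
  by (rule part_equivp_proportional)

text \<open>The value of \<open>proj\<close> at the zero vector carries no meaning.\<close>

definition proj :: "complex ^ 3 \<Rightarrow> cp2" where
  "proj u = abs_cp2 u"

abbreviation hom_coords :: "complex \<Rightarrow> complex \<Rightarrow> complex \<Rightarrow> cp2" where
  "hom_coords x y z \<equiv> proj (vector [x, y, z])"

lemma proportional_refl_iff: "proportional u u \<longleftrightarrow> u \<noteq> 0"
  unfolding proportional_def by (auto intro!: exI[of _ 1])

lemma proj_eq_iff:
  assumes "u \<noteq> 0" "v \<noteq> 0"
  shows "proj u = proj v \<longleftrightarrow> (\<exists>c. v = c *s u)"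
  using Quotient3_rel[OF Quotient3_cp2, of u v] assms
  unfolding proj_def by (auto simp: proportional_refl_iff proportional_def intro: exI[of _ 1])

lemma proj_surj: obtains u where "u \<noteq> 0" "p = proj u"
  using Quotient3_abs_rep[OF Quotient3_cp2, of p] Quotient3_rep_reflp[OF Quotient3_cp2, of p]
  unfolding proj_def proportional_refl_iff by metis

text \<open>The quotient topology; \<open>- {0}\<close> is open, so openness there is openness in $\mathbb{C}^3$.\<close>

instantiation cp2 :: topological_space
begin

definition open_cp2 :: "cp2 set \<Rightarrow> bool" where
  "open_cp2 U \<longleftrightarrow> open {u. u \<noteq> 0 \<and> proj u \<in> U}"

instance
proof
  show "open (UNIV :: cp2 set)"
    using open_Compl[OF closed_singleton[of "0 :: complex ^ 3"]]
    by (simp add: open_cp2_def Compl_eq)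
next
  fix S T :: "cp2 set" assume "open S" "open T"
  then have "open ({u. u \<noteq> 0 \<and> proj u \<in> S} \<inter> {u. u \<noteq> 0 \<and> proj u \<in> T})"
    unfolding open_cp2_def by blast
  then show "open (S \<inter> T)"
    unfolding open_cp2_def by (rule back_subst[of "open"]) auto
next
  fix K :: "cp2 set set" assume "\<forall>S\<in>K. open S"
  then have "open (\<Union>S\<in>K. {u. u \<noteq> 0 \<and> proj u \<in> S})"
    unfolding open_cp2_def by blast
  then show "open (\<Union>K)"
    unfolding open_cp2_def by (rule back_subst[of "open"]) auto
qed

end

lift_definition deltoid :: "cp2 \<Rightarrow> cp2" is
  "\<lambda>u. vector [(u $ 2)\<^sup>2 - 2 * u $ 1 * u $ 3, (u $ 1)\<^sup>2 - 2 * u $ 2 * u $ 3, (u $ 3)\<^sup>2]"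
proof -
  fix u v :: "complex ^ 3"
  let ?f = "\<lambda>u :: complex ^ 3. vector [(u $ 2)\<^sup>2 - 2 * u $ 1 * u $ 3,
    (u $ 1)\<^sup>2 - 2 * u $ 2 * u $ 3, (u $ 3)\<^sup>2] :: complex ^ 3"
  assume "proportional u v"
  then obtain c where uv: "u \<noteq> 0" "v \<noteq> 0" "v = c *s u"
    unfolding proportional_def by blast
  have nz: "?f w \<noteq> 0" if "w \<noteq> 0" for w
    using that by (auto simp: vec_eq_iff forall_3)
  have "?f v = c\<^sup>2 *s ?f u"
    by (simp add: uv(3) vec_eq_iff forall_3 power2_eq_square algebra_simps)
  then show "proportional (?f u) (?f v)"
    using nz uv unfolding proportional_def by blast
qed

lemma deltoid_hom_coords:
  assumes "x \<noteq> 0 \<or> y \<noteq> 0 \<or> z \<noteq> 0"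
  shows "deltoid (hom_coords x y z) = hom_coords (y\<^sup>2 - 2 * x * z) (x\<^sup>2 - 2 * y * z) (z\<^sup>2)"
proof -
  have "proportional (vector [x, y, z]) (vector [x, y, z])"
    using assms by (auto simp: proportional_refl_iff vec_eq_iff forall_3)
  then show ?thesis unfolding proj_def by (simp add: deltoid.abs_eq)
qed

lemma hom_coords_affine_inject:
  "hom_coords x y 1 = hom_coords x' y' 1 \<longleftrightarrow> x = x' \<and> y = y'"
proof -
  have "vector [x, y, 1] \<noteq> (0 :: complex ^ 3)" "vector [x', y', 1] \<noteq> (0 :: complex ^ 3)"
    by (auto simp: vec_eq_iff forall_3)
  then show ?thesis
    by (subst proj_eq_iff) (auto simp: vec_eq_iff forall_3)
qed

definition equicontinuous_family :: "('a \<Rightarrow> 'a \<Rightarrow> real) \<Rightarrow> ('a \<Rightarrow> 'a) set \<Rightarrow> 'a set \<Rightarrow> bool" where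
  "equicontinuous_family d F V \<longleftrightarrow>
    (\<forall>p\<in>V. \<forall>\<epsilon>>0. \<exists>\<delta>>0. \<forall>q\<in>V. d p q < \<delta> \<longrightarrow> (\<forall>g\<in>F. d (g p) (g q) < \<epsilon>))"

definition locally_equicontinuous ::
    "('a::topological_space \<Rightarrow> 'a \<Rightarrow> real) \<Rightarrow> ('a \<Rightarrow> 'a) set \<Rightarrow> 'a set \<Rightarrow> bool" where
  "locally_equicontinuous d F U \<longleftrightarrow>
    (\<forall>p\<in>U. \<exists>V. open V \<and> p \<in> V \<and> V \<subseteq> U \<and> equicontinuous_family d F V)"

definition fatou_set :: "('a::topological_space \<Rightarrow> 'a \<Rightarrow> real) \<Rightarrow> ('a \<Rightarrow> 'a) \<Rightarrow> 'a set" where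
  "fatou_set d f = \<Union>{U. open U \<and> locally_equicontinuous d (range (\<lambda>n. f ^^ n)) U}"

definition julia_set :: "('a::topological_space \<Rightarrow> 'a \<Rightarrow> real) \<Rightarrow> ('a \<Rightarrow> 'a) \<Rightarrow> 'a set" where
  "julia_set d f = UNIV - fatou_set d f"

text \<open>The union above is itself a member of the family, hence its largest member.\<close>

lemma fatou_set_largest:
  "open (fatou_set d f)"
  "locally_equicontinuous d (range (\<lambda>n. f ^^ n)) (fatou_set d f)"
  "\<lbrakk>open U; locally_equicontinuous d (range (\<lambda>n. f ^^ n)) U\<rbrakk> \<Longrightarrow> U \<subseteq> fatou_set d f"
proof -
  show "open (fatou_set d f)"
    unfolding fatou_set_def by blast
  show "locally_equicontinuous d (range (\<lambda>n. f ^^ n)) (fatou_set d f)"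
    unfolding locally_equicontinuous_def
  proof
    fix p assume "p \<in> fatou_set d f"
    then obtain U where U: "open U" "locally_equicontinuous d (range (\<lambda>n. f ^^ n)) U" "p \<in> U"
      unfolding fatou_set_def by blast
    then obtain V where "open V" "p \<in> V" "V \<subseteq> U" "equicontinuous_family d (range (\<lambda>n. f ^^ n)) V"
      unfolding locally_equicontinuous_def by blast
    moreover have "U \<subseteq> fatou_set d f" using U unfolding fatou_set_def by blast
    ultimately show "\<exists>V. open V \<and> p \<in> V \<and> V \<subseteq> fatou_set d f \<and>
        equicontinuous_family d (range (\<lambda>n. f ^^ n)) V"
      by blast
  qed
  show "\<lbrakk>open U; locally_equicontinuous d (range (\<lambda>n. f ^^ n)) U\<rbrakk> \<Longrightarrow> U \<subseteq> fatou_set d f"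
    unfolding fatou_set_def by blast
qed

definition induces_topology :: "('a::topological_space \<Rightarrow> 'a \<Rightarrow> real) \<Rightarrow> bool" where
  "induces_topology d \<longleftrightarrow>
    Metric_space UNIV d \<and> Metric_space.mtopology UNIV d = (euclidean :: 'a topology)"

text \<open>
  The projective plane is metrizable: identify a line with the orthogonal projection onto it and
  measure the distance of projections.
\<close>

definition line_projection :: "complex ^ 3 \<Rightarrow> complex ^ 3 ^ 3" where
  "line_projection u = (\<chi> i j. u $ i * cnj (u $ j) / of_real ((norm u)\<^sup>2))"

lemma norm_smult_vec: "norm (c *s (u :: complex ^ 3)) = norm c * norm u"
proof -
  have "(\<Sum>i\<in>UNIV. (norm c * norm (u $ i))\<^sup>2) = (norm c)\<^sup>2 * (\<Sum>i\<in>UNIV. (norm (u $ i))\<^sup>2)"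
    by (simp add: power_mult_distrib sum_distrib_left)
  then show ?thesis
    by (simp add: norm_vec_def L2_set_def norm_mult real_sqrt_mult)
qed

lemma norm_vec_3_sq: "of_real ((norm (u :: complex ^ 3))\<^sup>2) = (\<Sum>i\<in>UNIV. u $ i * cnj (u $ i))"
  by (simp add: norm_vec_def L2_set_def sum_nonneg complex_norm_square del: of_real_power)

lemma line_projection_eq_iff:
  assumes "u \<noteq> 0" "v \<noteq> 0"
  shows "line_projection u = line_projection v \<longleftrightarrow> proj u = proj v"
proof
  assume "proj u = proj v"
  then obtain c where c: "v = c *s u" using proj_eq_iff assms by blast
  then have "c \<noteq> 0" using assms by auto
  then have "(c * cnj c) / of_real ((norm c)\<^sup>2) = 1"
    by (simp add: complex_norm_square [symmetric])
  then show "line_projection u = line_projection v"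
    using \<open>c \<noteq> 0\<close> assms
    by (simp add: line_projection_def c vec_eq_iff norm_smult_vec power_mult_distrib
        complex_norm_square field_simps)
next
  assume eq: "line_projection u = line_projection v"
  define a where "a = (\<Sum>j\<in>UNIV. u $ j * cnj (v $ j))"
  have nz: "of_real ((norm u)\<^sup>2) \<noteq> (0 :: complex)" "of_real ((norm v)\<^sup>2) \<noteq> (0 :: complex)"
    using assms by auto
  have entry: "u $ i * cnj (u $ j) / of_real ((norm u)\<^sup>2) = v $ i * cnj (v $ j) / of_real ((norm v)\<^sup>2)"
    for i j
    using eq by (simp add: line_projection_def vec_eq_iff del: of_real_power)
  have "v $ i = (cnj a / of_real ((norm u)\<^sup>2)) * u $ i" for i
  proof -
    have "v $ i = v $ i * (\<Sum>j\<in>UNIV. v $ j * cnj (v $ j)) / of_real ((norm v)\<^sup>2)"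
      using nz unfolding norm_vec_3_sq by simp
    also have "\<dots> = (\<Sum>j\<in>UNIV. v $ i * cnj (v $ j) / of_real ((norm v)\<^sup>2) * v $ j)"
      by (simp add: sum_distrib_left sum_divide_distrib mult_ac)
    also have "\<dots> = (\<Sum>j\<in>UNIV. u $ i * cnj (u $ j) / of_real ((norm u)\<^sup>2) * v $ j)"
      by (simp only: entry)
    also have "\<dots> = (cnj a / of_real ((norm u)\<^sup>2)) * u $ i"
      by (simp add: a_def sum_distrib_left sum_distrib_right sum_divide_distrib mult_ac
          del: of_real_power)
    finally show ?thesis .
  qed
  then have "v = (cnj a / of_real ((norm u)\<^sup>2)) *s u"
    by (simp add: vec_eq_iff del: of_real_power)
  then show "proj u = proj v" using proj_eq_iff assms by blast
qed

lemma continuous_on_line_projection: "continuous_on (- {0}) line_projection"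
  unfolding line_projection_def by (intro continuous_intros) auto

lemma cp2_metrizable: "\<exists>d :: cp2 \<Rightarrow> cp2 \<Rightarrow> real. induces_topology d"
proof -
  define P where "P p = line_projection (SOME u. u \<noteq> 0 \<and> p = proj u)" for p
  have P: "P (proj u) = line_projection u" if "u \<noteq> 0" for u
  proof -
    have "\<exists>v. v \<noteq> 0 \<and> proj u = proj v" using that by blast
    then have "(SOME v. v \<noteq> 0 \<and> proj u = proj v) \<noteq> 0"
      "proj u = proj (SOME v. v \<noteq> 0 \<and> proj u = proj v)"
      by (metis (mono_tags, lifting) someI_ex)+
    then show ?thesis unfolding P_def using line_projection_eq_iff that by metis
  qed
  have inj: "p = q" if "P p = P q" for p q
    by (metis P line_projection_eq_iff proj_surj that)
  define d where "d p q = dist (P p) (P q)" for p q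
  interpret Metric_space UNIV d
    by unfold_locales (auto simp: d_def dist_commute dist_triangle intro: inj)
  have "openin mtopology U \<longleftrightarrow> open U" for U
  proof
    assume U: "openin mtopology U"
    show "open U"
      unfolding open_cp2_def
    proof (subst open_subopen, clarify)
      fix u :: "complex ^ 3" assume u: "u \<noteq> 0" "proj u \<in> U"
      then obtain r where r: "r > 0" "mball (proj u) r \<subseteq> U"
        using U unfolding openin_mtopology by blast
      define T where "T = - {0} \<inter> line_projection -` ball (line_projection u) r"
      have "open T"
        unfolding T_def by (intro continuous_open_preimage continuous_on_line_projection) auto
      moreover have "u \<in> T" using u r by (simp add: T_def)
      moreover have "T \<subseteq> {u. u \<noteq> 0 \<and> proj u \<in> U}"
        using r(2) u by (auto simp: T_def subset_iff in_mball d_def P)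
      ultimately show "\<exists>T. open T \<and> u \<in> T \<and> T \<subseteq> {u. u \<noteq> 0 \<and> proj u \<in> U}" by blast
    qed
  next
    assume U: "open U"
    define C where "C = sphere 0 1 \<inter> - {u. u \<noteq> 0 \<and> proj u \<in> U}"
    have "compact C"
      unfolding C_def using U unfolding open_cp2_def by (intro compact_Int_closed) auto
    then have "compact (line_projection ` C)"
      by (intro compact_continuous_image continuous_on_subset[OF continuous_on_line_projection])
        (auto simp: C_def)
    then have op: "open (- (line_projection ` C))" by (simp add: compact_imp_closed open_Compl)
    have "\<exists>r>0. mball p r \<subseteq> U" if p: "p \<in> U" for p
    proof -
      obtain u where u: "u \<noteq> 0" "p = proj u" by (rule proj_surj)
      have "P p \<notin> line_projection ` C"
      proof
        assume "P p \<in> line_projection ` C"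
        then obtain v where v: "v \<in> C" "P p = line_projection v" by blast
        then have "v \<noteq> 0" by (auto simp: C_def)
        then have "proj v = p" using v(2) P inj by metis
        then show False using v(1) p \<open>v \<noteq> 0\<close> by (simp add: C_def)
      qed
      then obtain r where r: "r > 0" "ball (P p) r \<subseteq> - (line_projection ` C)"
        using op open_contains_ball by (metis ComplI)
      have "q \<in> U" if "q \<in> mball p r" for q
      proof (rule ccontr)
        assume q: "q \<notin> U"
        obtain w where w: "w \<noteq> 0" "q = proj w" by (rule proj_surj)
        define v where "v = of_real (inverse (norm w)) *s w"
        have nv: "norm v = 1" using w by (simp add: v_def norm_smult_vec norm_inverse)
        then have v0: "v \<noteq> 0" by auto
        then have "proj v = q" using w proj_eq_iff[of w v] v_def by auto
        then have "v \<in> C" "line_projection v = P q"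
          using nv v0 q P by (auto simp: C_def)
        moreover have "P q \<in> ball (P p) r" using that by (simp add: d_def)
        ultimately show False using r(2) by (metis ComplD image_eqI subset_iff)
      qed
      then show ?thesis using r(1) by blast
    qed
    then show "openin mtopology U" unfolding openin_mtopology by blast
  qed
  then have "mtopology = (euclidean :: cp2 topology)"
    by (simp add: topology_eq)
  then show ?thesis
    unfolding induces_topology_def using Metric_space_axioms by blast
qed

end

(*
  Write x = a + b + c and y = ab + bc + ca with abc = 1.  In these coordinates the deltoid map is
  a, b, c -> a^-2, b^-2, c^-2.  If no modulus equals 1, two of them lie on the same side of 1 and the
  orbit is attracted by the cycle [1:0:0] <-> [0:1:0], with one phase when they are < 1 and the
  other when they are > 1.  If one modulus equals 1, both kinds of points accumulate at the given
  point, so the iterates are not equicontinuous there.  Hence the Julia set is given by the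
  condition that the cubic t^3 - x t^2 + y t - 1 has a unimodular root, and eliminating t from this
  equation and its conjugate gives the stated hypersurface.
*)
theory Submission
  imports Defs "HOL-Computational_Algebra.Fundamental_Theorem_Algebra"
begin

section \<open>Quotient topology of the projective plane and continuity of the map\<close>

lemma continuous_on_proj: "continuous_on (- {0}) proj"
proof -
  have "open (proj -` B \<inter> - {0})" if "open B" for B
  proof -
    have "proj -` B \<inter> - {0} = {u. u \<noteq> 0 \<and> proj u \<in> B}" by auto
    then show ?thesis using that by (simp add: open_cp2_def)
  qed
  then show ?thesis
    by (subst continuous_on_open_vimage) auto
qed

lemma tendsto_proj:
  assumes "(g \<longlongrightarrow> u) F" "u \<noteq> 0"
  shows "((\<lambda>k. proj (g k)) \<longlongrightarrow> proj u) F"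
proof -
  have "isCont proj u"
    using continuous_on_proj assms(2) by (simp add: continuous_on_eq_continuous_at open_Compl)
  then show ?thesis using assms(1) by (rule isCont_tendsto_compose)
qed

definition deltoid_lift :: "complex ^ 3 \<Rightarrow> complex ^ 3" where
  "deltoid_lift u =
    vector [(u $ 2)\<^sup>2 - 2 * u $ 1 * u $ 3, (u $ 1)\<^sup>2 - 2 * u $ 2 * u $ 3, (u $ 3)\<^sup>2]"

lemma deltoid_lift_nonzero: "u \<noteq> 0 \<Longrightarrow> deltoid_lift u \<noteq> 0"
  unfolding deltoid_lift_def by (auto simp: vec_eq_iff forall_3)

lemma deltoid_proj:
  assumes "u \<noteq> 0"
  shows "deltoid (proj u) = proj (deltoid_lift u)"
  using assms unfolding proj_def deltoid_lift_def
  by (simp add: deltoid.abs_eq proportional_refl_iff)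

lemma tendsto_vector_3:
  assumes "(f \<longlongrightarrow> x) F" "(g \<longlongrightarrow> y) F" "(h \<longlongrightarrow> z) F"
  shows "((\<lambda>k. vector [f k, g k, h k]) \<longlongrightarrow> (vector [x, y, z] :: complex ^ 3)) F"
proof (rule vec_tendstoI)
  fix i :: 3
  show "((\<lambda>k. (vector [f k, g k, h k] :: complex ^ 3) $ i) \<longlongrightarrow> vector [x, y, z] $ i) F"
    using exhaust_3[of i] assms by auto
qed

lemma continuous_on_deltoid_lift: "continuous_on S deltoid_lift"
  unfolding deltoid_lift_def continuous_on_def
  by (intro ballI tendsto_vector_3 tendsto_intros)

text \<open>Openness in the quotient is tested on nonzero vectors, and the polynomial lift is
  continuous and maps nonzero vectors to nonzero vectors.\<close>

lemma continuous_on_deltoid: "continuous_on UNIV deltoid"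
proof -
  have "open (deltoid -` B)" if "open B" for B
  proof -
    have "{u. u \<noteq> 0 \<and> proj u \<in> deltoid -` B} = - {0} \<inter> deltoid_lift -` {u. u \<noteq> 0 \<and> proj u \<in> B}"
      by (auto simp: deltoid_proj deltoid_lift_nonzero)
    moreover have "open \<dots>"
      using that continuous_on_deltoid_lift
      by (intro continuous_open_preimage) (auto simp: open_cp2_def)
    ultimately show ?thesis by (simp add: open_cp2_def)
  qed
  then show ?thesis by (simp add: continuous_on_open_vimage)
qed

lemma continuous_on_deltoid_funpow: "continuous_on UNIV (deltoid ^^ n)"
proof (induction n)
  case (Suc n)
  then show ?case
    using continuous_on_compose continuous_on_deltoid continuous_on_subset by (metis funpow.simps(2) top_greatest)
qed (simp add: id_def)

lemma open_deltoid_funpow_vimage: "open B \<Longrightarrow> open ((deltoid ^^ n) -` B)"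
  using continuous_on_deltoid_funpow[of n] by (simp add: continuous_on_open_vimage)

text \<open>The arbitrary metric \<open>d\<close> is compared with the quotient topology only here
  and in \<open>open_contains_metric_ball\<close>; everything else uses the metric axioms
  alone.\<close>

lemma open_metric_ball:
  assumes "induces_topology d"
  shows "open {q. d p q < e}"
proof -
  interpret Metric_space UNIV d using assms unfolding induces_topology_def by blast
  have "openin mtopology (mball p e)" by (rule openin_mball)
  moreover have "mtopology = euclidean" using assms unfolding induces_topology_def by blast
  ultimately show ?thesis by (simp add: mball_def)
qed

lemma open_contains_metric_ball:
  assumes "induces_topology d" "open U" "p \<in> U"
  obtains e where "e > 0" "{q. d p q < e} \<subseteq> U"
proof -
  interpret Metric_space UNIV d using assms unfolding induces_topology_def by blast
  have "mtopology = euclidean" using assms unfolding induces_topology_def by blast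
  then have "openin mtopology U" using assms(2) by simp
  then obtain e where "e > 0" "mball p e \<subseteq> U" using assms(3) unfolding openin_mtopology by blast
  then show ?thesis using that by (auto simp: mball_def)
qed

section \<open>The attracting cycle and its basin\<close>

text \<open>
  At each point of the cycle \<open>[1:0:0] \<leftrightarrow> [0:1:0]\<close> the linear part of the map is the nilpotent
  \<open>(y, z) \<mapsto> (-2z, 0)\<close>; the weight 4 on the last coordinate makes a single step contracting.
\<close>

definition coord_cone :: "3 \<Rightarrow> 3 \<Rightarrow> real \<Rightarrow> cp2 set" where
  "coord_cone i j c = {proj u | u. norm (u $ j) < c * norm (u $ i) \<and> 4 * norm (u $ 3) < c * norm (u $ i)}"

text \<open>Both inequalities are homogeneous and, being strict, exclude the zero vector; hence any
  representative decides membership.\<close>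

lemma proj_mem_coord_cone_iff:
  assumes "u \<noteq> 0"
  shows "proj u \<in> coord_cone i j c \<longleftrightarrow>
    norm (u $ j) < c * norm (u $ i) \<and> 4 * norm (u $ 3) < c * norm (u $ i)"
proof
  assume "proj u \<in> coord_cone i j c"
  then obtain v where v: "proj u = proj v" "norm (v $ j) < c * norm (v $ i)"
    "4 * norm (v $ 3) < c * norm (v $ i)"
    unfolding coord_cone_def by blast
  have "v \<noteq> 0" using v(2) by auto
  then obtain k where k: "v = k *s u" using v(1) assms proj_eq_iff by blast
  then have "norm k > 0" using \<open>v \<noteq> 0\<close> by auto
  moreover have "norm k * norm (u $ j) < norm k * (c * norm (u $ i))"
    "norm k * (4 * norm (u $ 3)) < norm k * (c * norm (u $ i))"
    using v(2,3) by (auto simp: k norm_mult mult_ac)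
  ultimately show "norm (u $ j) < c * norm (u $ i) \<and> 4 * norm (u $ 3) < c * norm (u $ i)"
    by simp
qed (unfold coord_cone_def, blast)

lemma open_coord_cone: "open (coord_cone i j c)"
proof -
  have "{u. u \<noteq> 0 \<and> proj u \<in> coord_cone i j c} =
    {u. norm (u $ j) < c * norm (u $ i)} \<inter> {u. 4 * norm (u $ 3) < c * norm (u $ i)}"
    (is "_ = ?S")
  proof (intro set_eqI)
    fix u
    show "u \<in> {u. u \<noteq> 0 \<and> proj u \<in> coord_cone i j c} \<longleftrightarrow> u \<in> ?S"
      by (cases "u = 0") (simp_all add: proj_mem_coord_cone_iff)
  qed
  moreover have "open \<dots>"
    by (intro open_Int open_Collect_less continuous_intros)
  ultimately show ?thesis by (simp add: open_cp2_def)
qed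

lemma axis_proj_mem_coord_cone:
  assumes "(i, j) \<in> {(1, 2), (2, 1)}" "c > 0"
  shows "proj (axis i 1) \<in> coord_cone i j c"
proof -
  have "axis i (1 :: complex) \<noteq> 0" by (simp add: axis_eq_0_iff)
  then show ?thesis using assms by (auto simp: proj_mem_coord_cone_iff axis_def)
qed

text \<open>The map exchanges the two points of the cycle, so \<open>i\<close> and \<open>j\<close>
  swap. The weight 4 bounds the leading term \<open>2 * (X * Z)\<close> by
  \<open>c * X * X / 2\<close>, and \<open>Y * Y\<close> adds at most \<open>c * X * X / 10\<close>,
  while the new dominant coordinate is at least \<open>199 / 200 * X * X\<close>. The factor 7/10
  leaves room, as 6/10 < 7/10 * 199/200.\<close>

lemma deltoid_coord_cone:
  assumes ij: "(i, j) \<in> {(1, 2), (2, 1)}" and c: "c \<le> 1 / 10" and p: "p \<in> coord_cone i j c"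
  shows "deltoid p \<in> coord_cone j i (7 / 10 * c)"
proof -
  obtain u where u: "p = proj u" and bounds: "norm (u $ j) < c * norm (u $ i)"
    "4 * norm (u $ 3) < c * norm (u $ i)"
    using p unfolding coord_cone_def by blast
  define X Y Z where "X = norm (u $ i)" and "Y = norm (u $ j)" and "Z = norm (u $ 3)"
  have X: "X > 0"
  proof (rule ccontr)
    assume "\<not> X > 0"
    then have "X = 0" unfolding X_def by simp
    then show False using bounds(1) by (simp add: X_def)
  qed
  have b: "0 \<le> Y" "0 \<le> Z" "Y < c * X" "4 * Z < c * X"
    using bounds by (auto simp: X_def Y_def Z_def)
  then have "0 < c * X" by linarith
  then have c0: "c > 0" using X by (simp add: zero_less_mult_iff)
  have cX: "c * X \<le> X / 10" using c X by (simp add: mult_right_mono)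
  have Y10: "Y \<le> X / 10" and Z40: "Z \<le> X / 40" using b cX by linarith+
  \<comment> \<open>In \<open>YY\<close> and \<open>ZZ\<close> one factor is bounded by a multiple
    of \<open>c * X\<close> and the other by a constant multiple of \<open>X\<close>, so that the
    products stay linear in \<open>c\<close>.\<close>
  have YY: "Y * Y \<le> c * X * (X / 10)" using b Y10 Z40 c0 X by (intro mult_mono) auto
  have YZ: "Y * Z \<le> (X / 10) * (X / 40)" using b Y10 Z40 c0 X by (intro mult_mono) auto
  have ZZ: "Z * Z \<le> c * X / 4 * (X / 40)" using b Y10 Z40 c0 X by (intro mult_mono) auto
  have XZ: "X * Z \<le> X * (c * X / 4)" using b X by (intro mult_left_mono) auto
  have cYZ: "c * (Y * Z) \<le> c * ((X / 10) * (X / 40))" using YZ c0 by (intro mult_left_mono) auto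
  have cXX0: "c * X * X > 0" using c0 X by simp
  have lower: "norm ((u $ i)\<^sup>2 - 2 * u $ j * u $ 3) \<ge> X * X - 2 * (Y * Z)"
    using norm_triangle_ineq2[of "(u $ i)\<^sup>2" "2 * u $ j * u $ 3"]
    by (simp add: X_def Y_def Z_def norm_mult norm_power power2_eq_square)
  have upper: "norm ((u $ j)\<^sup>2 - 2 * u $ i * u $ 3) \<le> Y * Y + 2 * (X * Z)"
    using norm_triangle_ineq4[of "(u $ j)\<^sup>2" "2 * u $ i * u $ 3"]
    by (simp add: X_def Y_def Z_def norm_mult norm_power power2_eq_square)
  have low: "7 / 10 * c * norm ((u $ i)\<^sup>2 - 2 * u $ j * u $ 3) \<ge> 7 / 10 * c * (X * X - 2 * (Y * Z))"
    using lower c0 by (intro mult_left_mono) auto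
  have "7 / 10 * c * (X * X - 2 * (Y * Z)) > Y * Y + 2 * (X * Z)"
    using YY XZ cYZ cXX0 by (simp add: algebra_simps)
  then have 1: "norm ((u $ j)\<^sup>2 - 2 * u $ i * u $ 3) < 7 / 10 * c * norm ((u $ i)\<^sup>2 - 2 * u $ j * u $ 3)"
    using upper low by linarith
  have "7 / 10 * c * (X * X - 2 * (Y * Z)) > 4 * (Z * Z)"
    using ZZ cYZ cXX0 by (simp add: algebra_simps)
  then have 2: "4 * norm ((u $ 3)\<^sup>2) < 7 / 10 * c * norm ((u $ i)\<^sup>2 - 2 * u $ j * u $ 3)"
    using low by (simp add: Z_def norm_power norm_mult power2_eq_square)
  have "u \<noteq> 0" using X by (auto simp: X_def)
  then have "proj (deltoid_lift u) \<in> coord_cone j i (7 / 10 * c)"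
    unfolding proj_mem_coord_cone_iff[OF deltoid_lift_nonzero[OF \<open>u \<noteq> 0\<close>]]
    using 1 2 ij by (auto simp: deltoid_lift_def mult_ac)
  then show ?thesis using \<open>u \<noteq> 0\<close> by (simp add: u deltoid_proj)
qed

lemma coord_cone_mono:
  assumes "c \<le> c'"
  shows "coord_cone i j c \<subseteq> coord_cone i j c'"
  unfolding coord_cone_def
  using mult_right_mono[OF assms norm_ge_zero] by (blast intro: less_le_trans)

lemma deltoid_funpow_coord_cone:
  assumes ij: "(i, j) \<in> {(1, 2), (2, 1)}" and p: "p \<in> coord_cone i j (1 / 10)"
  shows "(deltoid ^^ n) p \<in>
    (if even n then coord_cone i j ((7 / 10) ^ n / 10) else coord_cone j i ((7 / 10) ^ n / 10))"
proof (induction n)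
  case (Suc n)
  have le: "(7 / 10 :: real) ^ n / 10 \<le> 1 / 10" by (simp add: power_le_one)
  have ji: "(j, i) \<in> {(1, 2), (2, 1)}" using ij by auto
  have "7 / 10 * ((7 / 10 :: real) ^ n / 10) = (7 / 10) ^ Suc n / 10" by simp
  then show ?case
    using Suc deltoid_coord_cone[OF ij le] deltoid_coord_cone[OF ji le] by (auto split: if_splits)
qed (use p in simp)

text \<open>The cones form a neighbourhood basis: after rescaling a representative so that its
  coordinate \<open>i\<close> is 1, the other two have modulus below \<open>r / 2\<close>.\<close>

lemma coord_cone_subset_open:
  assumes "(i, j) \<in> {(1, 2), (2, 1)}" "open U" "proj (axis i 1) \<in> U"
  obtains c where "c > 0" "coord_cone i j c \<subseteq> U"
proof -
  have e0: "axis i (1 :: complex) \<noteq> 0" by (simp add: axis_eq_0_iff)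
  have "open {u. u \<noteq> 0 \<and> proj u \<in> U}" using assms(2) by (simp add: open_cp2_def)
  then obtain r where r: "r > 0" "ball (axis i 1) r \<subseteq> {u. u \<noteq> 0 \<and> proj u \<in> U}"
    using e0 assms(3) open_contains_ball by blast
  have "proj u \<in> U" if u: "norm (u $ j) < r / 2 * norm (u $ i)"
    "4 * norm (u $ 3) < r / 2 * norm (u $ i)" for u
  proof -
    have ui: "u $ i \<noteq> 0" using u(1) by auto
    define v where "v = inverse (u $ i) *s u"
    have v: "norm (v $ j) < r / 2" "norm (v $ 3) < r / 2" "v $ i = 1"
    proof -
      show "norm (v $ j) < r / 2" using u(1) ui by (simp add: v_def norm_divide divide_simps)
      show "norm (v $ 3) < r / 2" using u(2) ui
        by (simp add: v_def norm_divide divide_simps) (smt (verit) norm_ge_zero)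
      show "v $ i = 1" using ui by (simp add: v_def)
    qed
    have "dist (axis i 1) v \<le> (\<Sum>k\<in>UNIV. norm ((axis i 1 - v) $ k))"
      unfolding dist_norm norm_vec_def by (intro L2_set_le_sum) simp
    also have "\<dots> = norm (v $ j) + norm (v $ 3)"
      using assms(1) v(3) by (auto simp: sum_3 axis_def)
    also have "\<dots> < r" using v by simp
    finally have "v \<in> ball (axis i 1) r" by simp
    then have "proj v \<in> U" "v \<noteq> 0" using r(2) by blast+
    moreover have "u \<noteq> 0" using ui by auto
    moreover have "proj u = proj v" using \<open>u \<noteq> 0\<close> \<open>v \<noteq> 0\<close> proj_eq_iff v_def by blast
    ultimately show ?thesis by simp
  qed
  then have "coord_cone i j (r / 2) \<subseteq> U" unfolding coord_cone_def by blast
  then show ?thesis using that[of "r / 2"] r(1) by simp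
qed

text \<open>The point of this lemma is that \<open>N\<close> does not depend on \<open>p\<close>;
  equicontinuity of the late iterates rests on that.\<close>

lemma deltoid_funpow_coord_cone_uniform:
  assumes ij: "(i, j) \<in> {(1, 2), (2, 1)}"
    and U: "open U" "proj (axis i 1) \<in> U" and W: "open W" "proj (axis j 1) \<in> W"
  obtains N where "\<And>n p. n \<ge> N \<Longrightarrow> p \<in> coord_cone i j (1 / 10) \<Longrightarrow>
    (deltoid ^^ n) p \<in> (if even n then U else W)"
proof -
  have ji: "(j, i) \<in> {(1, 2), (2, 1)}" using ij by auto
  obtain c where c: "c > 0" "coord_cone i j c \<subseteq> U" using coord_cone_subset_open[OF ij U] .
  obtain c' where c': "c' > 0" "coord_cone j i c' \<subseteq> W" using coord_cone_subset_open[OF ji W] .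
  obtain N where N: "(7 / 10 :: real) ^ N < min c c'"
    using real_arch_pow_inv[of "min c c'" "7 / 10"] c c' by auto
  have "(deltoid ^^ n) p \<in> (if even n then U else W)" if n: "n \<ge> N" and p: "p \<in> coord_cone i j (1 / 10)" for n p
  proof -
    have "(7 / 10 :: real) ^ n \<le> (7 / 10) ^ N" using n by (intro power_decreasing) auto
    then have "(7 / 10 :: real) ^ n / 10 \<le> min c c'"
      using N c(1) c'(1) by linarith
    then have le: "(7 / 10 :: real) ^ n / 10 \<le> c" "(7 / 10 :: real) ^ n / 10 \<le> c'"
      by simp_all
    then show ?thesis
      using deltoid_funpow_coord_cone[OF ij p, of n] c(2) c'(2)
        coord_cone_mono[OF le(1), of i j] coord_cone_mono[OF le(2), of j i]
      by (auto split: if_splits)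
  qed
  then show ?thesis using that by blast
qed

text \<open>Some iterate takes \<open>p\<close> into the cone; let \<open>V\<close> be the preimage
  of the cone. For late iterates the parity of \<open>n - m\<close> alone decides which point of the
  cycle is near, so any two points of \<open>V\<close> are carried close to the same point. The
  finitely many early iterates are controlled by continuity, through \<open>T\<close>.\<close>

lemma fatou_of_tendsto:
  fixes i j :: 3
  assumes d: "induces_topology d" and ij: "(i, j) \<in> {(1, 2), (2, 1)}"
    and lim: "(\<lambda>n. (deltoid ^^ (2 * n)) p) \<longlonglongrightarrow> proj (axis i 1)"
  shows "p \<in> fatou_set d deltoid"
proof -
  interpret Metric_space UNIV d using d unfolding induces_topology_def by blast
  have "eventually (\<lambda>n. (deltoid ^^ (2 * n)) p \<in> coord_cone i j (1 / 10)) sequentially"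
    using lim open_coord_cone axis_proj_mem_coord_cone[OF ij] by (intro topological_tendstoD) auto
  then obtain m where m: "(deltoid ^^ m) p \<in> coord_cone i j (1 / 10)"
    unfolding eventually_sequentially by blast
  define V where "V = (deltoid ^^ m) -` coord_cone i j (1 / 10)"
  have "open V" unfolding V_def by (intro open_deltoid_funpow_vimage open_coord_cone)
  moreover have "equicontinuous_family d (range (\<lambda>n. deltoid ^^ n)) V"
    unfolding equicontinuous_family_def
  proof (intro ballI allI impI)
    fix q and e :: real assume q: "q \<in> V" and e: "e > 0"
    have mem: "x \<in> {y. d x y < e / 2}" for x using e by simp
    obtain N where N: "\<And>n p. n \<ge> N \<Longrightarrow> p \<in> coord_cone i j (1 / 10) \<Longrightarrow> (deltoid ^^ n) p \<in>
        (if even n then {y. d (proj (axis i 1)) y < e / 2} else {y. d (proj (axis j 1)) y < e / 2})"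
      by (rule deltoid_funpow_coord_cone_uniform[OF ij open_metric_ball[OF d] mem open_metric_ball[OF d] mem])
        blast
    have large: "d ((deltoid ^^ n) q) ((deltoid ^^ n) q') < e" if n: "n \<ge> N + m" and q': "q' \<in> V" for n q'
    proof -
      have split: "(deltoid ^^ n) x = (deltoid ^^ (n - m)) ((deltoid ^^ m) x)" for x
        using n by (metis add_leD2 comp_apply funpow_add le_add_diff_inverse2)
      have "(deltoid ^^ n) x \<in> (if even (n - m) then {y. d (proj (axis i 1)) y < e / 2}
          else {y. d (proj (axis j 1)) y < e / 2})" if "x \<in> V" for x
        unfolding split using that n N[of "n - m"] by (simp add: V_def)
      from this[OF q] this[OF q'] obtain z where "d z ((deltoid ^^ n) q) < e / 2" "d z ((deltoid ^^ n) q') < e / 2"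
        by (auto split: if_splits)
      then show ?thesis
        using triangle[of "(deltoid ^^ n) q" z "(deltoid ^^ n) q'"] commute[of z] by auto
    qed
    define T where "T = (\<Inter>n<N + m. (deltoid ^^ n) -` {y. d ((deltoid ^^ n) q) y < e})"
    have "open T"
      unfolding T_def by (intro open_INT ballI open_deltoid_funpow_vimage open_metric_ball[OF d]) simp
    moreover have "q \<in> T" using e by (simp add: T_def)
    ultimately obtain r where r: "r > 0" "{y. d q y < r} \<subseteq> T"
      using open_contains_metric_ball[OF d] by blast
    have "d ((deltoid ^^ n) q) ((deltoid ^^ n) q') < e" if "q' \<in> V" "d q q' < r" for n q'
      using large[of n q'] that r(2) by (cases "n < N + m") (auto simp: T_def subset_iff)
    then show "\<exists>\<delta>>0. \<forall>q'\<in>V. d q q' < \<delta> \<longrightarrow> (\<forall>g\<in>range (\<lambda>n. deltoid ^^ n). d (g q) (g q') < e)"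
      using r(1) by blast
  qed
  ultimately have "locally_equicontinuous d (range (\<lambda>n. deltoid ^^ n)) V"
    unfolding locally_equicontinuous_def by blast
  then have "V \<subseteq> fatou_set d deltoid" using \<open>open V\<close> by (intro fatou_set_largest(3))
  then show ?thesis using m by (auto simp: V_def)
qed

section \<open>Parameters in which the map is a power map\<close>

text \<open>Under \<open>abc = 1\<close> the second coordinate equals \<open>1/a + 1/b + 1/c\<close>.\<close>

definition torus_proj :: "complex \<Rightarrow> complex \<Rightarrow> complex \<Rightarrow> cp2" where
  "torus_proj a b c = hom_coords (a + b + c) (a * b + b * c + c * a) 1"

lemma torus_proj_rotate: "torus_proj a b c = torus_proj b c a"
  by (simp add: torus_proj_def add_ac mult_ac)

lemma torus_proj_swap: "torus_proj a b c = torus_proj c b a"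
  by (simp add: torus_proj_def add_ac mult_ac)

text \<open>Since \<open>b * c\<close> is \<open>1 / a\<close>, each parameter is inverted and
  squared; the form without division turns the claim into polynomial identities modulo
  \<open>a * b * c = 1\<close>.\<close>

lemma deltoid_torus_proj:
  assumes "a * b * c = 1"
  shows "deltoid (torus_proj a b c) = torus_proj ((b * c)\<^sup>2) ((c * a)\<^sup>2) ((a * b)\<^sup>2)"
proof -
  have "(a * b + b * c + c * a)\<^sup>2 - 2 * (a + b + c) = (b * c)\<^sup>2 + (c * a)\<^sup>2 + (a * b)\<^sup>2"
    using assms by algebra
  moreover have "(a + b + c)\<^sup>2 - 2 * (a * b + b * c + c * a) =
      (b * c)\<^sup>2 * (c * a)\<^sup>2 + (c * a)\<^sup>2 * (a * b)\<^sup>2 + (a * b)\<^sup>2 * (b * c)\<^sup>2"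
    using assms by algebra
  ultimately show ?thesis by (simp add: torus_proj_def deltoid_hom_coords)
qed

text \<open>Two steps cancel the inversion, which is why limits are taken along even iterates from
  here on.\<close>

lemma deltoid_deltoid_torus_proj:
  assumes "a * b * c = 1"
  shows "deltoid (deltoid (torus_proj a b c)) = torus_proj (a ^ 4) (b ^ 4) (c ^ 4)"
proof -
  have "(b * c)\<^sup>2 * (c * a)\<^sup>2 * (a * b)\<^sup>2 = 1" using assms by algebra
  moreover have "((c * a)\<^sup>2 * (a * b)\<^sup>2)\<^sup>2 = a ^ 4" using assms by algebra
  moreover have "((a * b)\<^sup>2 * (b * c)\<^sup>2)\<^sup>2 = b ^ 4" using assms by algebra
  moreover have "((b * c)\<^sup>2 * (c * a)\<^sup>2)\<^sup>2 = c ^ 4" using assms by algebra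
  ultimately show ?thesis using assms by (simp add: deltoid_torus_proj)
qed

lemma deltoid_funpow_torus_proj:
  assumes "a * b * c = 1"
  shows "(deltoid ^^ (2 * n)) (torus_proj a b c) = torus_proj (a ^ 4 ^ n) (b ^ 4 ^ n) (c ^ 4 ^ n)"
proof (induction n)
  case (Suc n)
  have "a ^ 4 ^ n * b ^ 4 ^ n * c ^ 4 ^ n = 1" using assms by (metis power_mult_distrib power_one)
  moreover have "x ^ 4 ^ Suc n = (x ^ 4 ^ n) ^ 4" for x :: complex
    by (simp add: power_mult[symmetric] mult.commute)
  ultimately show ?case using Suc by (simp add: deltoid_deltoid_torus_proj)
qed simp

lemma tendsto_hom_coords:
  assumes "(f \<longlongrightarrow> x) F" "(g \<longlongrightarrow> y) F" "(h \<longlongrightarrow> z) F" "x \<noteq> 0 \<or> y \<noteq> 0 \<or> z \<noteq> 0"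
  shows "((\<lambda>k. hom_coords (f k) (g k) (h k)) \<longlongrightarrow> hom_coords x y z) F"
  using assms by (intro tendsto_proj tendsto_vector_3) (auto simp: vec_eq_iff forall_3)

lemma hom_coords_scale:
  assumes "k \<noteq> 0" "x \<noteq> 0 \<or> y \<noteq> 0 \<or> z \<noteq> 0"
  shows "hom_coords x y z = hom_coords (k * x) (k * y) (k * z)"
proof -
  have "vector [x, y, z] \<noteq> (0 :: complex ^ 3)" "vector [k * x, k * y, k * z] \<noteq> (0 :: complex ^ 3)"
    using assms by (auto simp: vec_eq_iff forall_3)
  then show ?thesis by (subst proj_eq_iff) (auto simp: vec_eq_iff forall_3)
qed

lemma filterlim_power_4_power: "filterlim (\<lambda>n. 4 ^ n :: nat) at_top sequentially"
  by (rule filterlim_subseq) (simp add: strict_mono_def)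

lemma power_4_power_tendsto_zero:
  assumes "norm (b :: complex) < 1"
  shows "(\<lambda>n. b ^ 4 ^ n) \<longlonglongrightarrow> 0"
  using filterlim_compose[OF LIMSEQ_power_zero[OF assms] filterlim_power_4_power] .

lemma axis_1_eq_vector: "axis 1 1 = (vector [1, 0, 0] :: complex ^ 3)"
  and axis_2_eq_vector: "axis 2 1 = (vector [0, 1, 0] :: complex ^ 3)"
  by (auto simp: vec_eq_iff forall_3 axis_def)

text \<open>The power \<open>a ^ 4 ^ n\<close> diverges. Multiplying the homogeneous coordinates by
  its inverse \<open>B n * C n\<close> leaves polynomials in \<open>B n\<close> and
  \<open>C n\<close>, which tend to 0.\<close>

lemma torus_proj_tendsto_e1:
  assumes abc: "a * b * c = 1" and lt: "norm b < 1" "norm c < 1"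
  shows "(\<lambda>n. (deltoid ^^ (2 * n)) (torus_proj a b c)) \<longlonglongrightarrow> proj (axis 1 1)"
proof -
  define B C where "B n = b ^ 4 ^ n" and "C n = c ^ 4 ^ n" for n :: nat
  have lim: "B \<longlonglongrightarrow> 0" "C \<longlonglongrightarrow> 0"
    using lt unfolding B_def C_def by (auto intro!: power_4_power_tendsto_zero)
  have "(deltoid ^^ (2 * n)) (torus_proj a b c) =
      hom_coords (1 + B n * C n * (B n + C n)) (B n + C n + (B n * C n)\<^sup>2) (B n * C n)" for n
  proof -
    define A where "A = a ^ 4 ^ n"
    have ABC: "A * B n * C n = 1"
      using abc unfolding A_def B_def C_def by (metis power_mult_distrib power_one)
    have eqs: "B n * C n * (A + B n + C n) = 1 + B n * C n * (B n + C n)"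
      "B n * C n * (A * B n + B n * C n + C n * A) = B n + C n + (B n * C n)\<^sup>2"
      using ABC by algebra+
    have "(deltoid ^^ (2 * n)) (torus_proj a b c) = torus_proj A (B n) (C n)"
      using deltoid_funpow_torus_proj[OF abc] by (simp add: A_def B_def C_def)
    also have "\<dots> = hom_coords (B n * C n * (A + B n + C n))
        (B n * C n * (A * B n + B n * C n + C n * A)) (B n * C n * 1)"
      unfolding torus_proj_def using ABC by (intro hom_coords_scale) auto
    finally show ?thesis unfolding eqs by simp
  qed
  moreover have "(\<lambda>n. hom_coords (1 + B n * C n * (B n + C n)) (B n + C n + (B n * C n)\<^sup>2) (B n * C n))
      \<longlonglongrightarrow> hom_coords (1 + 0 * 0 * (0 + 0)) (0 + 0 + (0 * 0)\<^sup>2) (0 * 0)"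
    using lim by (intro tendsto_hom_coords tendsto_intros) auto
  ultimately show ?thesis by (simp add: axis_1_eq_vector)
qed

text \<open>Now the powers of \<open>b\<close> and \<open>c\<close> diverge, so \<open>B\<close> and
  \<open>C\<close> are powers of the inverses. The power of \<open>a\<close> equals
  \<open>B n * C n\<close>, and multiplying by this factor makes the second coordinate tend to 1 and
  the others to 0.\<close>

lemma torus_proj_tendsto_e2:
  assumes abc: "a * b * c = 1" and gt: "norm b > 1" "norm c > 1"
  shows "(\<lambda>n. (deltoid ^^ (2 * n)) (torus_proj a b c)) \<longlonglongrightarrow> proj (axis 2 1)"
proof -
  define B C where "B n = inverse b ^ 4 ^ n" and "C n = inverse c ^ 4 ^ n" for n :: nat
  have lim: "B \<longlonglongrightarrow> 0" "C \<longlonglongrightarrow> 0"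
    using gt unfolding B_def C_def
    by (auto intro!: power_4_power_tendsto_zero simp: norm_inverse inverse_less_1_iff)
  have "(deltoid ^^ (2 * n)) (torus_proj a b c) =
      hom_coords (B n + C n + (B n * C n)\<^sup>2) (1 + B n * C n * (B n + C n)) (B n * C n)" for n
  proof -
    define A' B' C' where "A' = a ^ 4 ^ n" and "B' = b ^ 4 ^ n" and "C' = c ^ 4 ^ n"
    have ABC: "A' * B' * C' = 1"
      using abc unfolding A'_def B'_def C'_def by (metis power_mult_distrib power_one)
    have "b \<noteq> 0" "c \<noteq> 0" using abc by auto
    then have inv: "B n * B' = 1" "C n * C' = 1"
      by (simp_all add: B_def C_def B'_def C'_def flip: power_mult_distrib)
    have eqs: "B n * C n * (A' + B' + C') = B n + C n + (B n * C n)\<^sup>2"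
      "B n * C n * (A' * B' + B' * C' + C' * A') = 1 + B n * C n * (B n + C n)"
      using ABC inv by algebra+
    have "(deltoid ^^ (2 * n)) (torus_proj a b c) = torus_proj A' B' C'"
      using deltoid_funpow_torus_proj[OF abc] by (simp add: A'_def B'_def C'_def)
    also have "\<dots> = hom_coords (B n * C n * (A' + B' + C'))
        (B n * C n * (A' * B' + B' * C' + C' * A')) (B n * C n * 1)"
      unfolding torus_proj_def using inv by (intro hom_coords_scale) auto
    finally show ?thesis unfolding eqs by simp
  qed
  moreover have "(\<lambda>n. hom_coords (B n + C n + (B n * C n)\<^sup>2) (1 + B n * C n * (B n + C n)) (B n * C n))
      \<longlonglongrightarrow> hom_coords (0 + 0 + (0 * 0)\<^sup>2) (1 + 0 * 0 * (0 + 0)) (0 * 0)"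
    using lim by (intro tendsto_hom_coords tendsto_intros) auto
  ultimately show ?thesis by (simp add: axis_2_eq_vector)
qed

section \<open>Fatou and Julia points in terms of the three moduli\<close>

text \<open>By the pigeonhole principle two moduli lie on the same side of 1; rotation moves them to
  the last two places.\<close>

lemma torus_proj_fatou:
  assumes d: "induces_topology d" and abc: "a * b * c = 1"
    and ne: "norm a \<noteq> 1" "norm b \<noteq> 1" "norm c \<noteq> 1"
  shows "torus_proj a b c \<in> fatou_set d deltoid"
proof -
  have same_side: "torus_proj a b c \<in> fatou_set d deltoid"
    if "a * b * c = 1" "norm b < 1 \<and> norm c < 1 \<or> norm b > 1 \<and> norm c > 1" for a b c
    using that torus_proj_tendsto_e1[of a b c] torus_proj_tendsto_e2[of a b c]
      fatou_of_tendsto[OF d, of 1 2] fatou_of_tendsto[OF d, of 2 1] by auto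
  consider "norm b < 1 \<and> norm c < 1 \<or> norm b > 1 \<and> norm c > 1"
    | "norm c < 1 \<and> norm a < 1 \<or> norm c > 1 \<and> norm a > 1"
    | "norm a < 1 \<and> norm b < 1 \<or> norm a > 1 \<and> norm b > 1"
    using ne by argo
  then show ?thesis
    using same_side[of a b c] same_side[of b c a] same_side[of c a b] abc
      torus_proj_rotate[of a b c] torus_proj_rotate[of b c a]
    by cases (simp_all add: mult_ac)
qed

lemma torus_proj_tendsto:
  assumes "(f \<longlongrightarrow> a) F" "(g \<longlongrightarrow> b) F" "(h \<longlongrightarrow> c) F"
  shows "((\<lambda>k. torus_proj (f k) (g k) (h k)) \<longlongrightarrow> torus_proj a b c) F"
  unfolding torus_proj_def using assms by (intro tendsto_hom_coords tendsto_intros) auto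

text \<open>
  Scaling the three coordinates by \<open>(s\<^sup>2, 1/s, 1/s)\<close> and by \<open>(s, s, 1/s\<^sup>2)\<close> with \<open>s > 1\<close> close to 1
  gives nearby points whose even iterates tend to \<open>[1:0:0]\<close> and to \<open>[0:1:0]\<close>, respectively.
\<close>

lemma torus_proj_not_fatou:
  assumes d: "induces_topology d" and abc: "a * b * c = 1"
    and nrm: "norm a \<ge> 1" "norm b = 1" "norm c \<le> 1"
  shows "torus_proj a b c \<notin> fatou_set d deltoid"
proof
  interpret Metric_space UNIV d using d unfolding induces_topology_def by blast
  define p where "p = torus_proj a b c"
  define e1 e2 where "e1 = proj (axis 1 1)" and "e2 = proj (axis 2 1)"
  assume "torus_proj a b c \<in> fatou_set d deltoid"
  then obtain V where V: "open V" "p \<in> V" "equicontinuous_family d (range (\<lambda>n. deltoid ^^ n)) V"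
    using fatou_set_largest(2) unfolding locally_equicontinuous_def p_def by metis
  have "e1 \<noteq> e2"
    unfolding e1_def e2_def axis_1_eq_vector axis_2_eq_vector
    by (subst proj_eq_iff) (auto simp: vec_eq_iff forall_3)
  then have "d e1 e2 > 0" by (simp add: mdist_pos_less)
  \<comment> \<open>A quarter, because the path from \<open>e1\<close> to \<open>e2\<close> has four
    legs, through \<open>g q1\<close>, \<open>g p\<close> and \<open>g q2\<close>.\<close>
  define e where "e = d e1 e2 / 4"
  have e: "e > 0" using \<open>d e1 e2 > 0\<close> by (simp add: e_def)
  obtain r where r: "r > 0" "\<And>q n. q \<in> V \<Longrightarrow> d p q < r \<Longrightarrow> d ((deltoid ^^ n) p) ((deltoid ^^ n) q) < e"
    using V(2,3) e unfolding equicontinuous_family_def by blast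
  define T where "T = V \<inter> {q. d p q < r}"
  have T: "open T" "p \<in> T"
    unfolding T_def using V r open_metric_ball[OF d] by auto
  have s: "((\<lambda>s. complex_of_real s) \<longlongrightarrow> 1) (at_right 1)"
    using tendsto_of_real[OF tendsto_ident_at, of 1 "{1<..}"] by simp
  have "((\<lambda>s. torus_proj (a * of_real s ^ 2) (b / of_real s) (c / of_real s)) \<longlongrightarrow>
      torus_proj (a * 1 ^ 2) (b / 1) (c / 1)) (at_right 1)"
    by (intro torus_proj_tendsto tendsto_intros s) auto
  then have ev1: "eventually (\<lambda>s. torus_proj (a * of_real s ^ 2) (b / of_real s) (c / of_real s) \<in> T) (at_right 1)"
    using T by (intro topological_tendstoD) (auto simp: p_def)
  \<comment> \<open>The rotated order puts the two parameters pushed outside the unit circle last,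
    as \<open>torus_proj_tendsto_e2\<close> expects.\<close>
  have "((\<lambda>s. torus_proj (c / of_real s ^ 2) (a * of_real s) (b * of_real s)) \<longlongrightarrow>
      torus_proj (c / 1 ^ 2) (a * 1) (b * 1)) (at_right 1)"
    by (intro torus_proj_tendsto tendsto_intros s) auto
  then have ev2: "eventually (\<lambda>s. torus_proj (c / of_real s ^ 2) (a * of_real s) (b * of_real s) \<in> T) (at_right 1)"
    using T torus_proj_rotate[of c a b] by (intro topological_tendstoD) (auto simp: p_def)
  have ev3: "eventually (\<lambda>s::real. s > 1) (at_right 1)" by (rule eventually_at_right_less)
  obtain s where s: "s > 1"
    "torus_proj (a * of_real s ^ 2) (b / of_real s) (c / of_real s) \<in> T"
    "torus_proj (c / of_real s ^ 2) (a * of_real s) (b * of_real s) \<in> T"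
    using eventually_happens[OF eventually_conj[OF ev1 eventually_conj[OF ev2 ev3]]]
    by (auto simp: trivial_limit_at_right_real)
  define q1 where "q1 = torus_proj (a * of_real s ^ 2) (b / of_real s) (c / of_real s)"
  define q2 where "q2 = torus_proj (c / of_real s ^ 2) (a * of_real s) (b * of_real s)"
  have prod: "a * of_real s ^ 2 * (b / of_real s) * (c / of_real s) = 1"
    "c / of_real s ^ 2 * (a * of_real s) * (b * of_real s) = 1"
    using s(1) abc by (simp_all add: power2_eq_square mult_ac)
  have lim1: "(\<lambda>n. (deltoid ^^ (2 * n)) q1) \<longlonglongrightarrow> e1"
    unfolding q1_def e1_def using s(1) nrm
    by (intro torus_proj_tendsto_e1 prod) (simp_all add: norm_divide)
  have lim2: "(\<lambda>n. (deltoid ^^ (2 * n)) q2) \<longlonglongrightarrow> e2"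
    unfolding q2_def e2_def using s(1) nrm
    by (intro torus_proj_tendsto_e2 prod) (simp_all add: norm_mult less_le_trans[OF _ mult_right_mono[of 1, simplified]])
  have "eventually (\<lambda>n. (deltoid ^^ (2 * n)) q1 \<in> {y. d e1 y < e}) sequentially"
    using lim1 open_metric_ball[OF d] e by (intro topological_tendstoD) auto
  moreover have "eventually (\<lambda>n. (deltoid ^^ (2 * n)) q2 \<in> {y. d e2 y < e}) sequentially"
    using lim2 open_metric_ball[OF d] e by (intro topological_tendstoD) auto
  ultimately obtain n where n: "d e1 ((deltoid ^^ (2 * n)) q1) < e" "d e2 ((deltoid ^^ (2 * n)) q2) < e"
    using eventually_happens[OF eventually_conj] by fastforce
  define g where "g = deltoid ^^ (2 * n)"
  have "d (g p) (g q1) < e" "d (g p) (g q2) < e"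
    using r(2) s(2,3) unfolding T_def q1_def q2_def g_def by auto
  moreover have "d e1 (g q1) < e" "d e2 (g q2) < e" using n by (simp_all add: g_def)
  moreover have "d e1 e2 \<le> d e1 (g q1) + d (g p) (g q1) + d (g p) (g q2) + d e2 (g q2)"
    using triangle[of e1 "g q1" e2] triangle[of "g q1" "g p" e2] triangle[of "g p" "g q2" e2]
      commute[of "g q1" "g p"] commute[of "g q2" e2] by simp
  ultimately show False unfolding e_def by linarith
qed

lemma torus_proj_julia_iff:
  assumes d: "induces_topology d" and abc: "a * b * c = 1"
  shows "torus_proj a b c \<in> julia_set d deltoid \<longleftrightarrow> norm a = 1 \<or> norm b = 1 \<or> norm c = 1"
proof -
  \<comment> \<open>As \<open>norm a * norm c = 1\<close>, one of these moduli is at least 1 and the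
    other at most 1; if they are in the wrong order, \<open>torus_proj_swap\<close> exchanges
    them.\<close>
  have middle: "torus_proj a b c \<notin> fatou_set d deltoid" if "a * b * c = 1" "norm b = 1" for a b c
  proof -
    have ac: "norm a * norm c = 1" using that by (metis mult.right_neutral norm_mult norm_one)
    have "norm a \<ge> 1 \<and> norm c \<le> 1 \<or> norm c \<ge> 1 \<and> norm a \<le> 1"
    proof (cases "norm a \<ge> 1")
      case True
      then have "norm c \<le> norm a * norm c" by (simp add: mult_le_cancel_right1)
      then show ?thesis using ac True by simp
    next
      case False
      then have "norm a * norm c \<le> norm c" by (simp add: mult_le_cancel_right2)
      then show ?thesis using ac False by simp
    qed
    then show ?thesis
      using torus_proj_not_fatou[OF d, of a b c] torus_proj_not_fatou[OF d, of c b a] that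
        torus_proj_swap[of a b c] by (auto simp: mult_ac)
  qed
  show ?thesis
    using middle[of a b c] middle[of b c a] middle[of c a b] torus_proj_fatou[OF d abc] abc
      torus_proj_rotate[of a b c] torus_proj_rotate[of b c a]
    by (auto simp: julia_set_def mult_ac)
qed

section \<open>Roots of the cubic and elimination of the parameters\<close>

text \<open>The parameters are the roots of t^3 - x t^2 + y t - 1: one root \<open>a\<close> exists
  and is nonzero because of the constant term, and \<open>b\<close>, \<open>c\<close> solve t^2 - (x
  - a) t + 1/a = 0, with \<open>D\<close> a square root of its discriminant.\<close>

lemma torus_proj_surj:
  fixes x y :: complex
  obtains a b c where "a * b * c = 1" "x = a + b + c" "y = a * b + b * c + c * a"
proof -
  have "\<not> constant (poly [:- 1, y, - x, 1:])"
    by (simp add: constant_degree)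
  then obtain a where "poly [:- 1, y, - x, 1:] a = 0"
    using fundamental_theorem_of_algebra by blast
  then have a: "a ^ 3 - x * a\<^sup>2 + y * a - 1 = 0"
    by (simp add: algebra_simps power2_eq_square power3_eq_cube)
  then have "a \<noteq> 0" by auto
  define D where "D = csqrt ((x - a)\<^sup>2 - 4 / a)"
  define b c where "b = (x - a + D) / 2" and "c = (x - a - D) / 2"
  have "D\<^sup>2 = (x - a)\<^sup>2 - 4 / a" by (simp add: D_def)
  moreover have "b * c = ((x - a)\<^sup>2 - D\<^sup>2) / 4"
    by (simp add: b_def c_def field_simps power2_eq_square)
  ultimately have "b * c = 1 / a" by simp
  then have abc: "a * b * c = 1" using \<open>a \<noteq> 0\<close> by (simp add: mult.assoc)
  have x: "x = a + b + c" by (simp add: b_def c_def field_simps)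
  have "a * y = a * (a * b + b * c + c * a)" using a abc unfolding x by algebra
  then have "y = a * b + b * c + c * a" using \<open>a \<noteq> 0\<close> by simp
  then show ?thesis using abc x that by blast
qed

text \<open>
  If \<open>t\<close> is a unimodular root, subtracting the conjugate equation gives \<open>w t = - cnj w\<close> for
  \<open>w = x - cnj y\<close>.  For \<open>w \<noteq> 0\<close> the only candidate is therefore \<open>t = - cnj w / w\<close>, and \<open>E\<close> below is
  \<open>- w\<^sup>3\<close> times the cubic at this point.  For \<open>w = 0\<close> the roots are permuted by \<open>t \<mapsto> 1 / cnj t\<close>,
  so one of the three is unimodular.
\<close>

lemma unimodular_root_iff:
  assumes abc: "a * b * c = 1" and x: "x = a + b + c" and y: "y = a * b + b * c + c * a"
  shows "norm a = 1 \<or> norm b = 1 \<or> norm c = 1 \<longleftrightarrow>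
    2 * Re ((x - cnj y) ^ 3) + Re ((x - cnj y)\<^sup>2 * ((cnj x)\<^sup>2 - y\<^sup>2)) = 0"
    (is "_ \<longleftrightarrow> ?R = 0")
proof -
  define w where "w = x - cnj y"
  have factor: "t ^ 3 - x * t\<^sup>2 + y * t - 1 = (t - a) * (t - b) * (t - c)" for t
    using abc unfolding x y by algebra
  \<comment> \<open>This form makes unimodularity a polynomial condition that \<open>algebra\<close>
    can use.\<close>
  have unimod: "norm t = 1 \<longleftrightarrow> t * cnj t = 1" for t
    by (metis complex_norm_square norm_ge_zero of_real_1 of_real_eq_iff of_real_power one_power2
        power2_eq_iff_nonneg zero_le_one)
  define E where "E = cnj w ^ 3 + x * (cnj w)\<^sup>2 * w + y * cnj w * w\<^sup>2 + w ^ 3"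
  have "of_real ?R = E"
  proof -
    define Z where "Z = w\<^sup>2 * ((cnj x)\<^sup>2 - y\<^sup>2)"
    \<comment> \<open>Doubling clears the denominator in Re v = (v + cnj v) / 2, so that a
      polynomial identity in \<open>x\<close>, \<open>y\<close> and their conjugates
      remains.\<close>
    have "2 * of_real ?R = 2 * (w ^ 3 + cnj (w ^ 3)) + (Z + cnj Z)"
      unfolding complex_add_cnj by (simp add: w_def Z_def)
    also have "\<dots> = 2 * E"
      unfolding E_def Z_def w_def by (simp add: algebra_simps power2_eq_square power3_eq_cube)
    finally show ?thesis by (metis mult_cancel_left zero_neq_numeral)
  qed
  then have R: "?R = 0 \<longleftrightarrow> E = 0" by (metis of_real_eq_0_iff)
  show ?thesis
  proof (cases "w = 0")
    case True
    have "norm a = 1 \<or> norm b = 1 \<or> norm c = 1"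
    proof -
      have "a \<noteq> 0" using abc by auto
      define t where "t = 1 / cnj a"
      have ta: "t * cnj a = 1" using \<open>a \<noteq> 0\<close> by (simp add: t_def)
      have xy: "cnj x = y" "cnj y = x" using True by (auto simp: w_def)
      have "a ^ 3 - x * a\<^sup>2 + y * a - 1 = 0" by (simp add: factor)
      then have "cnj (a ^ 3 - x * a\<^sup>2 + y * a - 1) = 0" by simp
      then have "cnj a ^ 3 - y * (cnj a)\<^sup>2 + x * cnj a - 1 = 0" by (simp add: xy)
      \<comment> \<open>The conjugate equation is multiplied by \<open>t ^ 3\<close>, which reverses
        its coefficients.\<close>
      then have "t ^ 3 - x * t\<^sup>2 + y * t - 1 = 0" using ta by algebra
      then consider "t = a" | "t = b" | "t = c" unfolding factor by auto
      then show ?thesis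
      proof cases
        case 1
        then show ?thesis using ta unimod by simp
      next
        \<comment> \<open>Here \<open>a\<close> and \<open>b\<close> are mirror images in the unit
          circle, and the product 1 forces the remaining root \<open>c\<close> onto the
          circle.\<close>
        case 2
        then have "t * (a * c) = t * cnj a" using abc ta by (simp add: mult_ac)
        then have "a * c = cnj a" using \<open>a \<noteq> 0\<close> by (simp add: t_def)
        then have "norm a * norm c = norm a" by (metis complex_mod_cnj norm_mult)
        then show ?thesis using \<open>a \<noteq> 0\<close> by simp
      next
        case 3
        then have "t * (a * b) = t * cnj a" using abc ta by (simp add: mult_ac)
        then have "a * b = cnj a" using \<open>a \<noteq> 0\<close> by (simp add: t_def)
        then have "norm a * norm b = norm a" by (metis complex_mod_cnj norm_mult)
        then show ?thesis using \<open>a \<noteq> 0\<close> by simp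
      qed
    qed
    moreover have "E = 0" by (simp add: E_def True)
    ultimately show ?thesis using R by blast
  next
    case False
    define t where "t = - cnj w / w"
    have wt: "w * t = - cnj w" using False by (simp add: t_def)
    have nt: "norm t = 1" using False by (simp add: t_def norm_divide)
    have "w ^ 3 * (t ^ 3 - x * t\<^sup>2 + y * t - 1) = - E" using wt unfolding E_def by algebra
    then have Et: "E = 0 \<longleftrightarrow> t ^ 3 - x * t\<^sup>2 + y * t - 1 = 0"
      using False by (metis mult_eq_0_iff neg_equal_0_iff_equal power_eq_0_iff)
    have uniq: "t' = t" if nt': "norm t' = 1" and root: "t' ^ 3 - x * t'\<^sup>2 + y * t' - 1 = 0" for t'
    proof -
      have tt: "t' * cnj t' = 1" using nt' unimod by blast
      have "cnj (t' ^ 3 - x * t'\<^sup>2 + y * t' - 1) = 0" using root by simp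
      then have "cnj t' ^ 3 - cnj x * (cnj t')\<^sup>2 + cnj y * cnj t' - 1 = 0" by simp
      \<comment> \<open>The conjugate equation times \<open>t' ^ 3\<close>, added to the original
        one, cancels the cubic and constant terms; dividing by \<open>t'\<close> leaves a linear
        equation.\<close>
      then have "(x - cnj y) * t' = - (cnj x - y)"
        using root tt by algebra
      then have "w * t' = - cnj w" by (simp add: w_def)
      then show ?thesis using wt False by (metis mult_cancel_left)
    qed
    have "norm a = 1 \<or> norm b = 1 \<or> norm c = 1 \<longleftrightarrow> t ^ 3 - x * t\<^sup>2 + y * t - 1 = 0"
      using uniq[of a] uniq[of b] uniq[of c] nt unfolding factor by auto
    then show ?thesis using R Et by blast
  qed
qed

theorem corollary1:
  fixes d :: "cp2 \<Rightarrow> cp2 \<Rightarrow> real"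
  assumes "induces_topology d"
  shows "{(x, y). hom_coords x y 1 \<in> julia_set d deltoid} =
    {(x, y). 2 * Re ((x - cnj y) ^ 3) + Re ((x - cnj y)\<^sup>2 * ((cnj x)\<^sup>2 - y\<^sup>2)) = 0}"
proof -
  have "hom_coords x y 1 \<in> julia_set d deltoid \<longleftrightarrow>
    2 * Re ((x - cnj y) ^ 3) + Re ((x - cnj y)\<^sup>2 * ((cnj x)\<^sup>2 - y\<^sup>2)) = 0" for x y
  proof -
    obtain a b c where abc: "a * b * c = 1" "x = a + b + c" "y = a * b + b * c + c * a"
      by (rule torus_proj_surj)
    have "hom_coords x y 1 = torus_proj a b c" unfolding torus_proj_def abc(2,3) ..
    then show ?thesis
      using torus_proj_julia_iff[OF assms abc(1)] unimodular_root_iff[OF abc] by simp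
  qed
  then show ?thesis by simp
qed

end
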